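(* Let $s\ge 1$ be an integer, let $\alpha\in(0,1)$, and consider testing the null hypotheses $H_i: P\in\omega_i$, $i=1,\ldots,s$, based on $p$-values $\hat p_1,\ldots,\hat p_s$ satisfying $$P\{\hat p_i\le u\}\le u\quad\text{for every } u\in(0,1)\text{ and every } P\in\omega_i ,\qquad i=1,\ldots,s.$$ Let $P\in\Omega$ be the true distribution, let $\hat q_1,\ldots,\hat q_{|I|}$ denote the $p$-values corresponding to the true null hypotheses and $\hat r_1,\ldots,\hat r_{s-|I|}$ the $p$-values corresponding to the false null hypotheses, and assume that for every $i=1,\ldots,|I|$ and every $u\in(0,1)$, $$P\{\hat q_i\le u\mid \hat r_1,\ldots,\hat r_{s-|I|}\}\le u$$ (almost surely). Then the stepdown procedure with constants $$\alpha_i^*=\min\Big\{\frac{s\alpha}{(s-i+1)^2},\,1\Big\},\qquad i=1,\ldots,s,$$ satisfies $FDR\le\alpha$.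
   Context: Setup. Data $X$ have distribution $P$ belonging to a model $\Omega$ (a family of probability distributions). Each null hypothesis $H_i$ is identified with a subset $\omega_i\subset\Omega$. For $P\in\Omega$, $I=I(P)=\{i: P\in\omega_i\}$ is the set of indices of true null hypotheses, and $|I|$ is its cardinality; $H_i$ is called false if $i\notin I(P)$. The $p$-values $\hat p_1,\ldots,\hat p_s$ are $[0,1]$-valued statistics (functions of $X$). Stepdown procedure with constants $c_1\le c_2\le\cdots\le c_s$. Let $\hat p_{(1)}\le\cdots\le\hat p_{(s)}$ be the ordered $p$-values (ties broken arbitrarily) with corresponding hypotheses $H_{(1)},\ldots,H_{(s)}$. If $\hat p_{(1)}>c_1$, reject no hypotheses. Otherwise reject $H_{(1)},\ldots,H_{(r)}$, where $r$ is the largest index such that $\hat p_{(1)}\le c_1,\ldots,\hat p_{(r)}\le c_r$. False discovery proportion and rate. $FDP$ is the number of rejected hypotheses $H_i$ with $i\in I(P)$ divided by the total number of rejected hypotheses, and $FDP=0$ if there are no rejections. $FDR=E(FDP)$, the expectation being under $P$. *)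

theory Defs
  imports "HOL-Probability.Probability"
begin

text \<open>
  The data are the identity on the sample space \<open>M\<close>; a model is a set of probability
  measures with the \<sigma>-algebra of \<open>M\<close>. Hypotheses and p-values are indexed by \<open>{1..s}\<close>.
\<close>

definition model_on :: "'x measure \<Rightarrow> 'x measure set \<Rightarrow> bool" where
  "model_on M \<Omega> \<longleftrightarrow> (\<forall>P\<in>\<Omega>. prob_space P \<and> sets P = sets M)"

definition true_nulls :: "nat \<Rightarrow> (nat \<Rightarrow> 'x measure set) \<Rightarrow> 'x measure \<Rightarrow> nat set" where
  "true_nulls s \<omega> P = {i \<in> {1..s}. P \<in> \<omega> i}"

text \<open>
  \<open>\<sigma> k\<close> is the index of the \<open>k\<close>-th smallest p-value; if there are ties, several \<open>\<sigma>\<close> qualify.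
\<close>

definition orders_pvalues :: "nat \<Rightarrow> (nat \<Rightarrow> real) \<Rightarrow> (nat \<Rightarrow> nat) \<Rightarrow> bool" where
  "orders_pvalues s p \<sigma> \<longleftrightarrow> bij_betw \<sigma> {1..s} {1..s} \<and> mono_on {1..s} (\<lambda>k. p (\<sigma> k))"

text \<open>The value is \<open>0\<close> exactly if \<open>s = 0\<close> or the smallest p-value exceeds \<open>c 1\<close>.\<close>

definition stepdown_count ::
    "nat \<Rightarrow> (nat \<Rightarrow> real) \<Rightarrow> (nat \<Rightarrow> real) \<Rightarrow> (nat \<Rightarrow> nat) \<Rightarrow> nat" where
  "stepdown_count s c p \<sigma> = Max {r \<in> {0..s}. \<forall>j\<in>{1..r}. p (\<sigma> j) \<le> c j}"

definition stepdown_rejected ::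
    "nat \<Rightarrow> (nat \<Rightarrow> real) \<Rightarrow> (nat \<Rightarrow> real) \<Rightarrow> (nat \<Rightarrow> nat) \<Rightarrow> nat set" where
  "stepdown_rejected s c p \<sigma> = \<sigma> ` {1..stepdown_count s c p \<sigma>}"

definition FDP :: "nat set \<Rightarrow> nat set \<Rightarrow> real" where
  "FDP I R = (if R = {} then 0 else real (card (R \<inter> I)) / real (card R))"

definition FDR :: "'x measure \<Rightarrow> nat set \<Rightarrow> ('x \<Rightarrow> nat set) \<Rightarrow> real" where
  "FDR P I R = (\<integral>x. FDP I (R x) \<partial>P)"

definition generated_by ::
    "'x measure \<Rightarrow> nat set \<Rightarrow> (nat \<Rightarrow> 'x \<Rightarrow> real) \<Rightarrow> 'x measure" where
  "generated_by P J p =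
     vimage_algebra (space P) (\<lambda>x. \<lambda>j\<in>J. p j x) (Pi\<^sub>M J (\<lambda>_. borel))"

definition prob_given :: "'x measure \<Rightarrow> 'x measure \<Rightarrow> 'x set \<Rightarrow> 'x \<Rightarrow> real" where
  "prob_given P F A = real_cond_exp P F (indicator A)"

definition alpha_star :: "nat \<Rightarrow> real \<Rightarrow> nat \<Rightarrow> real" where
  "alpha_star s \<alpha> i = min (real s * \<alpha> / (real s - real i + 1)\<^sup>2) 1"

text \<open>
  For nondecreasing constants the rejected set does not depend on how ties are broken, so the
  false discovery proportion is a random variable even if the tie-breaking rule
  is not measurable.
\<close>

lemma stepdown_rejected_eq:
  assumes "orders_pvalues s p \<sigma>" and c: "mono_on {1..s} c"
  defines "r \<equiv> Max {r \<in> {0..s}. \<forall>j\<in>{1..r}. j \<le> card {i \<in> {1..s}. p i \<le> c j}}"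
  shows "stepdown_rejected s c p \<sigma> = {i \<in> {1..s}. 1 \<le> r \<and> p i \<le> c r}"
proof -
  have bij: "bij_betw \<sigma> {1..s} {1..s}" and mo: "mono_on {1..s} (\<lambda>k. p (\<sigma> k))"
    using assms by (auto simp: orders_pvalues_def)
  have key: "p (\<sigma> j) \<le> t \<longleftrightarrow> j \<le> card {i \<in> {1..s}. p i \<le> t}" if j: "j \<in> {1..s}" for j t
  proof -
    have img: "{i \<in> {1..s}. p i \<le> t} = \<sigma> ` {k \<in> {1..s}. p (\<sigma> k) \<le> t}"
    proof (intro set_eqI iffI)
      fix i assume i: "i \<in> {i \<in> {1..s}. p i \<le> t}"
      then obtain k where "k \<in> {1..s}" "i = \<sigma> k"
        using bij unfolding bij_betw_def by blast
      then show "i \<in> \<sigma> ` {k \<in> {1..s}. p (\<sigma> k) \<le> t}" using i by blast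
    qed (use bij in \<open>auto simp: bij_betw_def\<close>)
    have inj: "inj_on \<sigma> {k \<in> {1..s}. p (\<sigma> k) \<le> t}"
      using bij unfolding bij_betw_def by (auto intro: inj_on_subset)
    have card: "card {i \<in> {1..s}. p i \<le> t} = card {k \<in> {1..s}. p (\<sigma> k) \<le> t}"
      unfolding img by (rule card_image[OF inj])
    show ?thesis
    proof
      assume a: "p (\<sigma> j) \<le> t"
      have "{1..j} \<subseteq> {k \<in> {1..s}. p (\<sigma> k) \<le> t}"
        using a j mo by (fastforce simp: monotone_on_def)
      then have "card {1..j} \<le> card {k \<in> {1..s}. p (\<sigma> k) \<le> t}"
        by (intro card_mono) auto
      then show "j \<le> card {i \<in> {1..s}. p i \<le> t}" unfolding card by simp
    next
      assume a: "j \<le> card {i \<in> {1..s}. p i \<le> t}"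
      show "p (\<sigma> j) \<le> t"
      proof (rule ccontr)
        assume b: "\<not> p (\<sigma> j) \<le> t"
        have "{k \<in> {1..s}. p (\<sigma> k) \<le> t} \<subseteq> {1..<j}"
        proof
          fix k assume k: "k \<in> {k \<in> {1..s}. p (\<sigma> k) \<le> t}"
          have "\<not> j \<le> k"
          proof
            assume "j \<le> k"
            then have "p (\<sigma> j) \<le> p (\<sigma> k)" using mo k j by (auto simp: monotone_on_def)
            then show False using b k by auto
          qed
          then show "k \<in> {1..<j}" using k by auto
        qed
        then have "card {k \<in> {1..s}. p (\<sigma> k) \<le> t} \<le> card {1..<j}" by (intro card_mono) auto
        then show False using a j unfolding card by auto
      qed
    qed
  qed
  let ?S = "{r \<in> {0..s}. \<forall>j\<in>{1..r}. p (\<sigma> j) \<le> c j}"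
  have "?S = {r \<in> {0..s}. \<forall>j\<in>{1..r}. j \<le> card {i \<in> {1..s}. p i \<le> c j}}"
    using key by auto
  then have r: "r = Max ?S" by (simp add: r_def)
  have fin: "finite ?S" and z: "0 \<in> ?S" by auto
  have rS: "r \<in> ?S" unfolding r using fin z by (intro Max_in) auto
  have rmax: "k \<le> r" if "k \<in> ?S" for k unfolding r using fin that by (rule Max_ge)
  have "\<sigma> ` {1..r} = {i \<in> {1..s}. 1 \<le> r \<and> p i \<le> c r}"
  proof (intro set_eqI iffI)
    fix i assume "i \<in> \<sigma> ` {1..r}"
    then obtain k where k: "k \<in> {1..r}" "i = \<sigma> k" by auto
    then have ks: "k \<in> {1..s}" "r \<in> {1..s}" using rS by auto
    have "p (\<sigma> k) \<le> c k" using rS k by auto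
    also have "c k \<le> c r" using c k ks by (auto simp: monotone_on_def)
    finally have "p i \<le> c r" using k by simp
    moreover have "i \<in> {1..s}" using bij ks k unfolding bij_betw_def by blast
    ultimately show "i \<in> {i \<in> {1..s}. 1 \<le> r \<and> p i \<le> c r}" using ks by simp
  next
    fix i assume i: "i \<in> {i \<in> {1..s}. 1 \<le> r \<and> p i \<le> c r}"
    then obtain k where k: "k \<in> {1..s}" "i = \<sigma> k"
      using bij unfolding bij_betw_def by blast
    have "k \<le> r"
    proof (rule ccontr)
      assume "\<not> k \<le> r"
      then have s: "Suc r \<in> {1..s}" "r \<in> {1..s}" "Suc r \<le> k" using k i by auto
      have "p (\<sigma> (Suc r)) \<le> p (\<sigma> k)" using mo s k by (auto simp: monotone_on_def)
      also have "\<dots> \<le> c r" using i k by simp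
      also have "c r \<le> c (Suc r)" using c s by (auto simp: monotone_on_def)
      finally have "Suc r \<in> ?S" using rS s by (auto simp: le_Suc_eq)
      then show False using rmax by fastforce
    qed
    then show "i \<in> \<sigma> ` {1..r}" using k by auto
  qed
  then show ?thesis unfolding stepdown_rejected_def stepdown_count_def r .
qed

lemma mono_on_alpha_star:
  assumes "0 \<le> \<alpha>"
  shows "mono_on {1..s} (alpha_star s \<alpha>)"
proof (rule mono_onI)
  fix i j assume ij: "i \<in> {1..s}" "j \<in> {1..s}" "i \<le> j"
  have "(real s - real j + 1)\<^sup>2 \<le> (real s - real i + 1)\<^sup>2"
    using ij by (intro power_mono) auto
  moreover have "0 < (real s - real j + 1)\<^sup>2" "0 < (real s - real i + 1)\<^sup>2"
    using ij by (intro zero_less_power; simp)+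
  ultimately have "real s * \<alpha> / (real s - real i + 1)\<^sup>2 \<le> real s * \<alpha> / (real s - real j + 1)\<^sup>2"
    using assms by (intro divide_left_mono mult_pos_pos) auto
  then show "alpha_star s \<alpha> i \<le> alpha_star s \<alpha> j"
    unfolding alpha_star_def by auto
qed

lemma integrable_FDP_stepdown:
  fixes p :: "nat \<Rightarrow> 'x \<Rightarrow> real"
  assumes "prob_space P" and p: "\<And>i. i \<in> {1..s} \<Longrightarrow> p i \<in> borel_measurable P"
    and ord: "\<And>x. x \<in> space P \<Longrightarrow> orders_pvalues s (\<lambda>i. p i x) (\<sigma> x)"
    and c: "mono_on {1..s} c"
  shows "integrable P (\<lambda>x. FDP I (stepdown_rejected s c (\<lambda>i. p i x) (\<sigma> x)))"
proof -
  interpret prob_space P by fact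
  define Q where "Q x = (\<lambda>i\<in>{1..s}. \<lambda>j\<in>{1..s}. p i x \<le> c j)" for x
  define T :: "(nat \<Rightarrow> nat \<Rightarrow> bool) set"
    where "T = Pi\<^sub>E {1..s} (\<lambda>_. Pi\<^sub>E {1..s} (\<lambda>_. UNIV))"
  define h where "h b =
    (let r = Max {r \<in> {0..s}. \<forall>j\<in>{1..r}. j \<le> card {i \<in> {1..s}. b i j}}
     in FDP I {i \<in> {1..s}. 1 \<le> r \<and> b i r})" for b :: "nat \<Rightarrow> nat \<Rightarrow> bool"
  have finT: "finite T" unfolding T_def by (intro finite_PiE) auto
  have QT: "Q x \<in> T" for x unfolding Q_def T_def by auto
  have Qm: "Q \<in> measurable P (count_space T)"
  proof (rule measurable_count_space_eq2[THEN iffD2, OF finT], intro conjI ballI)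
    show "Q \<in> space P \<rightarrow> T" using QT by auto
    fix b assume b: "b \<in> T"
    have "Q -` {b} \<inter> space P = {x \<in> space P. \<forall>i\<in>{1..s}. \<forall>j\<in>{1..s}. (p i x \<le> c j) = b i j}"
    proof (intro set_eqI iffI)
      fix x assume "x \<in> Q -` {b} \<inter> space P"
      then show "x \<in> {x \<in> space P. \<forall>i\<in>{1..s}. \<forall>j\<in>{1..s}. (p i x \<le> c j) = b i j}"
        by (auto simp: Q_def)
    next
      fix x assume x: "x \<in> {x \<in> space P. \<forall>i\<in>{1..s}. \<forall>j\<in>{1..s}. (p i x \<le> c j) = b i j}"
      have "Q x = b"
      proof (rule PiE_ext)
        show "Q x \<in> Pi\<^sub>E {1..s} (\<lambda>_. Pi\<^sub>E {1..s} (\<lambda>_. UNIV))" using QT by (simp add: T_def)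
        show "b \<in> Pi\<^sub>E {1..s} (\<lambda>_. Pi\<^sub>E {1..s} (\<lambda>_. UNIV))" using b by (simp add: T_def)
        fix i assume i: "i \<in> {1..s}"
        show "Q x i = b i"
        proof (rule PiE_ext)
          show "Q x i \<in> Pi\<^sub>E {1..s} (\<lambda>_. UNIV)" using i QT[of x] unfolding T_def by (rule PiE_mem[rotated])
          show "b i \<in> Pi\<^sub>E {1..s} (\<lambda>_. UNIV)" using i b unfolding T_def by (rule PiE_mem[rotated])
          fix j assume "j \<in> {1..s}"
          then show "Q x i j = b i j" using x i by (auto simp: Q_def)
        qed
      qed
      then show "x \<in> Q -` {b} \<inter> space P" using x by auto
    qed
    also have "\<dots> \<in> sets P"
    proof (intro sets.sets_Collect_finite_All)
      fix i j assume ij: "i \<in> {1..s}" "j \<in> {1..s}"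
      have [measurable]: "p i \<in> borel_measurable P" using p ij by auto
      show "{x \<in> space P. (p i x \<le> c j) = b i j} \<in> sets P" by measurable
    qed simp_all
    finally show "Q -` {b} \<inter> space P \<in> sets P" .
  qed
  have hQ: "FDP I (stepdown_rejected s c (\<lambda>i. p i x) (\<sigma> x)) = h (Q x)" if x: "x \<in> space P" for x
  proof -
    define S where "S = {r \<in> {0..s}. \<forall>j\<in>{1..r}. j \<le> card {i \<in> {1..s}. p i x \<le> c j}}"
    define r where "r = Max S"
    have "card {i \<in> {1..s}. Q x i j} = card {i \<in> {1..s}. p i x \<le> c j}" if "j \<in> {1..s}" for j
      using that by (intro arg_cong[where f = card]) (auto simp: Q_def)
    then have seq: "{r \<in> {0..s}. \<forall>j\<in>{1..r}. j \<le> card {i \<in> {1..s}. Q x i j}} = S"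
      unfolding S_def by (intro Collect_cong conj_cong refl ball_cong) simp_all
    have "finite S" "0 \<in> S" unfolding S_def by simp_all
    then have "r \<in> S" unfolding r_def by (intro Max_in) blast+
    then have "r \<le> s" unfolding S_def by simp
    then have eq: "{i \<in> {1..s}. 1 \<le> r \<and> Q x i r} = {i \<in> {1..s}. 1 \<le> r \<and> p i x \<le> c r}"
      unfolding Q_def by (intro Collect_cong) auto
    have "h (Q x) = FDP I {i \<in> {1..s}. 1 \<le> r \<and> Q x i r}"
      unfolding h_def Let_def seq r_def[symmetric] by (rule refl)
    moreover have "stepdown_rejected s c (\<lambda>i. p i x) (\<sigma> x) = {i \<in> {1..s}. 1 \<le> r \<and> p i x \<le> c r}"
      unfolding r_def S_def by (rule stepdown_rejected_eq[OF ord[OF x] c])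
    ultimately show ?thesis by (simp only: eq)
  qed
  have "(\<lambda>x. h (Q x)) \<in> borel_measurable P"
    by (rule measurable_compose[OF Qm]) simp
  then have m: "(\<lambda>x. FDP I (stepdown_rejected s c (\<lambda>i. p i x) (\<sigma> x))) \<in> borel_measurable P"
    by (rule measurable_cong[THEN iffD2, rotated]) (rule hQ)
  have bd: "norm (FDP I R) \<le> 1" if "finite R" for R
    using that card_mono[of R "R \<inter> I"] by (auto simp: FDP_def divide_le_eq_1)
  have "norm (FDP I (stepdown_rejected s c (\<lambda>i. p i x) (\<sigma> x))) \<le> 1" for x
    by (rule bd) (simp add: stepdown_rejected_def)
  then have "AE x in P. norm (FDP I (stepdown_rejected s c (\<lambda>i. p i x) (\<sigma> x))) \<le> 1"
    by (rule AE_I2)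
  then show ?thesis
    using m by (rule integrable_const_bound)
qed

end

theory Submission
  imports Defs
begin

text \<open>
  Let \<open>m\<close> be the number of true nulls, and run the stepdown procedure on the false nulls alone; let
  \<open>j\<close> be its number of rejections. The full procedure rejects at least \<open>j\<close> false nulls, and it
  rejects a true null only if some true p-value is at most \<open>c (j + 1)\<close>. So the false discovery
  proportion is at most \<open>m / (m + j)\<close> times the indicator of that event. As \<open>j\<close> is a function of the
  false p-values, the union bound for the conditional probability gives
  \<open>m\<^sup>2 * s * \<alpha> / ((m + j) * (s - j)\<^sup>2)\<close>, which is increasing in \<open>m\<close> and equals \<open>\<alpha>\<close> at the extreme
  value \<open>m = s - j\<close>.
\<close>

section \<open>Order-free stepdown counts\<close>

text \<open>
  The stepdown count for the hypotheses in \<open>J\<close>, free of any ordering: the \<open>l\<close>-th smallest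
  p-value is at most \<open>c l\<close> iff at least \<open>l\<close> of the p-values are.
\<close>

definition rejection_count :: "nat set \<Rightarrow> (nat \<Rightarrow> real) \<Rightarrow> (nat \<Rightarrow> real) \<Rightarrow> nat" where
  "rejection_count J c p = Max {r \<in> {0..card J}. \<forall>l\<in>{1..r}. l \<le> card {i \<in> J. p i \<le> c l}}"

lemma
  shows rejection_count_le_card: "rejection_count J c p \<le> card J"
    and rejection_count_le_count: "l \<in> {1..rejection_count J c p} \<Longrightarrow> l \<le> card {i \<in> J. p i \<le> c l}"
    and rejection_count_greatest:
      "r \<le> card J \<Longrightarrow> (\<And>l. l \<in> {1..r} \<Longrightarrow> l \<le> card {i \<in> J. p i \<le> c l}) \<Longrightarrow> r \<le> rejection_count J c p"
proof -
  let ?S = "{r \<in> {0..card J}. \<forall>l\<in>{1..r}. l \<le> card {i \<in> J. p i \<le> c l}}"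
  have "0 \<in> ?S" "finite ?S" by auto
  then have S: "rejection_count J c p \<in> ?S" unfolding rejection_count_def by (intro Max_in) blast+
  show "rejection_count J c p \<le> card J" using S by simp
  show "l \<in> {1..rejection_count J c p} \<Longrightarrow> l \<le> card {i \<in> J. p i \<le> c l}" using S by blast
  show "r \<le> rejection_count J c p" if "r \<le> card J" "\<And>l. l \<in> {1..r} \<Longrightarrow> l \<le> card {i \<in> J. p i \<le> c l}"
    unfolding rejection_count_def using \<open>finite ?S\<close> that by (intro Max_ge) auto
qed

lemma rejection_count_mono:
  assumes "finite K" "J \<subseteq> K"
  shows "rejection_count J c p \<le> rejection_count K c p"
proof (rule rejection_count_greatest)
  show "rejection_count J c p \<le> card K" using rejection_count_le_card[of J c p] card_mono[OF assms] by simp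
  fix l assume "l \<in> {1..rejection_count J c p}"
  then have "l \<le> card {i \<in> J. p i \<le> c l}" by (rule rejection_count_le_count)
  also have "\<dots> \<le> card {i \<in> K. p i \<le> c l}" using assms by (intro card_mono) auto
  finally show "l \<le> card {i \<in> K. p i \<le> c l}" .
qed

text \<open>By maximality of the count. A count equal to \<open>card J\<close> is covered too, since
  \<open>J\<close> does not have \<open>card J + 1\<close> members to reach the next level.\<close>

lemma not_Suc_rejection_count_le_count:
  assumes "finite J"
  shows "\<not> Suc (rejection_count J c p) \<le> card {i \<in> J. p i \<le> c (Suc (rejection_count J c p))}"
proof
  assume a: "Suc (rejection_count J c p) \<le> card {i \<in> J. p i \<le> c (Suc (rejection_count J c p))}"
  have "card {i \<in> J. p i \<le> c (Suc (rejection_count J c p))} \<le> card J"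
    using assms by (intro card_mono) auto
  then have "Suc (rejection_count J c p) \<le> rejection_count J c p"
    using a rejection_count_le_count[of _ J c p] by (intro rejection_count_greatest) (auto simp: le_Suc_eq)
  then show False by simp
qed

section \<open>Pointwise bound on the false discovery proportion\<close>

text \<open>If every true p-value exceeded \<open>c (Suc j)\<close>, only false nulls would count at
  step \<open>j + 1\<close>. The full procedure would then stop by step \<open>j\<close>, with a
  threshold too small to reach any true null.\<close>

lemma true_rejection_imp_le:
  assumes "I \<subseteq> {1..s}" and c: "mono_on {1..s} c" and ord: "orders_pvalues s p \<sigma>"
    and ne: "stepdown_rejected s c p \<sigma> \<inter> I \<noteq> {}"
  defines "j \<equiv> rejection_count ({1..s} - I) c p"
  shows "\<exists>i\<in>I. p i \<le> c (Suc j)"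
proof (rule ccontr)
  assume "\<not> ?thesis"
  then have gt: "p i > c (Suc j)" if "i \<in> I" for i using that by force
  define r where "r = rejection_count {1..s} c p"
  have R: "stepdown_rejected s c p \<sigma> = {i \<in> {1..s}. 1 \<le> r \<and> p i \<le> c r}"
    using stepdown_rejected_eq[OF ord c] by (simp add: r_def rejection_count_def)
  obtain i where i: "i \<in> I" "i \<in> {1..s}" "1 \<le> r" "p i \<le> c r" using ne R by auto
  have rs: "r \<le> s" using rejection_count_le_card[of "{1..s}" c p] by (simp add: r_def)
  show False
  proof (cases "Suc j \<le> r")
    case True
    have "Suc j \<le> card {i \<in> {1..s}. p i \<le> c (Suc j)}"
      using True by (intro rejection_count_le_count) (simp add: r_def)
    also have "{i \<in> {1..s}. p i \<le> c (Suc j)} = {i \<in> {1..s} - I. p i \<le> c (Suc j)}"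
      using gt by force
    finally show False
      using not_Suc_rejection_count_le_count[of "{1..s} - I" c p] by (simp add: j_def)
  next
    case False
    \<comment> \<open>The true null \<open>i\<close> leaves fewer than \<open>s\<close> false ones,
      so \<open>Suc j\<close> stays in the range where \<open>c\<close> is known to be
      monotone.\<close>
    have "card ({1..s} - I) < card {1..s}"
      using i(1,2) by (intro psubset_card_mono finite_atLeastAtMost) blast
    then have "Suc j \<le> s" using rejection_count_le_card[of "{1..s} - I" c p] by (simp add: j_def)
    then have "c r \<le> c (Suc j)" using c False i rs by (auto simp: monotone_on_def)
    then show False using gt[OF i(1)] i(4) by simp
  qed
qed

text \<open>Adding the true nulls can only raise the count, so the final threshold
  \<open>c r\<close> is at least \<open>c j\<close>, and at least \<open>j\<close> false p-values
  already lie at or below \<open>c j\<close>.\<close>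

lemma rejection_count_le_false_rejections:
  fixes I :: "nat set"
  assumes c: "mono_on {1..s} c" and ord: "orders_pvalues s p \<sigma>"
  defines "j \<equiv> rejection_count ({1..s} - I) c p"
  shows "j \<le> card (stepdown_rejected s c p \<sigma> - I)"
proof (cases "j = 0")
  case False
  define r where "r = rejection_count {1..s} c p"
  have R: "stepdown_rejected s c p \<sigma> = {i \<in> {1..s}. 1 \<le> r \<and> p i \<le> c r}"
    using stepdown_rejected_eq[OF ord c] by (simp add: r_def rejection_count_def)
  have jr: "j \<le> r" unfolding j_def r_def by (rule rejection_count_mono) auto
  have rs: "r \<le> s" using rejection_count_le_card[of "{1..s}" c p] by (simp add: r_def)
  have cc: "c j \<le> c r" using c jr rs False by (auto simp: monotone_on_def)
  have "j \<le> card {i \<in> {1..s} - I. p i \<le> c j}"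
    using False unfolding j_def by (intro rejection_count_le_count) simp
  also have "\<dots> \<le> card (stepdown_rejected s c p \<sigma> - I)"
    unfolding R using cc jr False by (intro card_mono) auto
  finally show ?thesis .
qed simp

text \<open>The ratio V / (V + F) grows with the number V of true rejections and falls with the
  number F of false ones, so V = \<open>card I\<close> and F = \<open>j\<close> bound it. The
  indicator that some true p-value is small is replaced by a sum over \<open>I\<close>, which can be
  integrated term by term.\<close>

lemma FDP_stepdown_le:
  assumes I: "I \<subseteq> {1..s}" and c: "mono_on {1..s} c" and ord: "orders_pvalues s p \<sigma>"
  defines "j \<equiv> rejection_count ({1..s} - I) c p"
  shows "FDP I (stepdown_rejected s c p \<sigma>)
         \<le> (\<Sum>i\<in>I. real (card I) / (real (card I) + real j) * of_bool (p i \<le> c (Suc j)))"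
    (is "_ \<le> (\<Sum>i\<in>I. ?w * _ i)")
proof (cases "stepdown_rejected s c p \<sigma> \<inter> I = {}")
  case True
  \<comment> \<open>This includes the empty rejected set, where \<open>FDP\<close> is 0 by
    convention.\<close>
  then show ?thesis by (auto simp: FDP_def intro!: sum_nonneg)
next
  case False
  let ?R = "stepdown_rejected s c p \<sigma>"
  have fin: "finite I" "finite ?R"
    using I finite_subset by (auto simp: stepdown_rejected_def)
  obtain i where i: "i \<in> I" "p i \<le> c (Suc j)"
    using true_rejection_imp_le[OF I c ord False] unfolding j_def by blast
  define V where "V = card (?R \<inter> I)"
  have V: "0 < V" "V \<le> card I"
    using False fin card_mono[of I "?R \<inter> I"] by (auto simp: V_def card_gt_0_iff)
  have F: "j \<le> card (?R - I)" unfolding j_def by (rule rejection_count_le_false_rejections[OF c ord])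
  have "card ?R = V + card (?R - I)"
    using card_Diff_subset_Int[of ?R I] card_mono[of ?R "?R \<inter> I"] fin by (simp add: V_def)
  then have "FDP I ?R = real V / (real V + real (card (?R - I)))"
    using False by (auto simp: FDP_def V_def)
  also have "\<dots> \<le> real V / (real V + real j)"
    using V F by (intro divide_left_mono mult_pos_pos) auto
  also have "\<dots> \<le> ?w"
  proof -
    have "real V * real j \<le> real (card I) * real j"
      using V by (intro mult_right_mono) auto
    then have "real V * (real (card I) + real j) \<le> real (card I) * (real V + real j)"
      by (simp add: distrib_left mult.commute)
    then show ?thesis using V by (simp add: pos_divide_le_eq pos_le_divide_eq)
  qed
  also have "\<dots> = ?w * of_bool (p i \<le> c (Suc j))" using i by simp
  also have "\<dots> \<le> (\<Sum>i\<in>I. ?w * of_bool (p i \<le> c (Suc j)))"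
    using i fin by (intro member_le_sum) auto
  finally show ?thesis .
qed

section \<open>Arithmetic of the constants\<close>

text \<open>The outer factor \<open>m\<close> counts the terms of the union bound. With d = s - j
  the claim reduces to m^2 (d + j) \<le> d^2 (m + j), which follows from m \<le> d.\<close>

lemma alpha_star_weight_le:
  assumes "0 \<le> \<alpha>" "0 < m" "m + j \<le> s"
  shows "real m * (real m / (real m + real j) * alpha_star s \<alpha> (Suc j)) \<le> \<alpha>"
proof -
  define d where "d = real s - real j"
  have d: "real m \<le> d" "0 < d" using assms by (auto simp: d_def)
  have "real m * real m * (d + real j) \<le> d * d * (real m + real j)"
  proof -
    have "real m * (real m * d) \<le> d * (real m * d)" "real m * real m * real j \<le> d * d * real j"
      using d by (intro mult_right_mono mult_mono; simp)+
    then show ?thesis by (simp add: algebra_simps)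
  qed
  then have "real m * real m * real s / ((real m + real j) * d\<^sup>2) \<le> 1"
    using d assms by (simp add: d_def divide_le_eq power2_eq_square mult_ac)
  then have "real m * real m * real s / ((real m + real j) * d\<^sup>2) * \<alpha> \<le> 1 * \<alpha>"
    using assms(1) by (rule mult_right_mono)
  \<comment> \<open>The cap at 1 only lowers the constant, and the index \<open>Suc j\<close>
    cancels the \<open>+ 1\<close> in its denominator.\<close>
  moreover have "alpha_star s \<alpha> (Suc j) \<le> real s * \<alpha> / d\<^sup>2"
    by (simp add: alpha_star_def d_def)
  then have "real m * (real m / (real m + real j) * alpha_star s \<alpha> (Suc j))
      \<le> real m * (real m / (real m + real j) * (real s * \<alpha> / d\<^sup>2))"
    by (intro mult_left_mono) auto
  ultimately show ?thesis by (simp add: mult_ac)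
qed

section \<open>Conditioning on the false p-values\<close>

lemma measurable_generated_by:
  assumes "i \<in> J"
  shows "p i \<in> borel_measurable (generated_by P J p)"
proof -
  have "(\<lambda>x. \<lambda>j\<in>J. p j x) \<in> measurable (generated_by P J p) (Pi\<^sub>M J (\<lambda>_. borel))"
    unfolding generated_by_def by (rule measurable_vimage_algebra1) (auto simp: space_PiM)
  from measurable_compose[OF this measurable_component_singleton[OF assms]]
  show ?thesis using assms by simp
qed

lemma subalgebra_generated_by:
  assumes "\<And>i. i \<in> J \<Longrightarrow> p i \<in> borel_measurable P"
  shows "subalgebra P (generated_by P J p)"
proof -
  have "(\<lambda>x. \<lambda>j\<in>J. p j x) \<in> measurable P (Pi\<^sub>M J (\<lambda>_. borel))"
    using assms by (rule measurable_restrict)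
  then have "sets (generated_by P J p) \<subseteq> sets P"
    unfolding generated_by_def by (rule sets_image_in_sets[OF refl])
  then show ?thesis by (simp add: subalgebra_def generated_by_def)
qed

text \<open>With \<open>N\<close> generated by the false p-values, this places the event that the
  count has a given value in the conditioning sigma-algebra.\<close>

lemma measurable_rejection_count [measurable]:
  assumes [measurable]: "\<And>i. i \<in> J \<Longrightarrow> p i \<in> borel_measurable N"
  shows "(\<lambda>x. rejection_count J c (\<lambda>i. p i x)) \<in> measurable N (count_space UNIV)"
proof -
  have [measurable]: "(\<lambda>x. card {i \<in> J. p i x \<le> t}) \<in> measurable N (count_space UNIV)" for t
  proof (rule measurable_card)
    fix i show "{x \<in> space N. i \<in> {i \<in> J. p i x \<le> t}} \<in> sets N"
      by (cases "i \<in> J") auto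
  qed
  show ?thesis unfolding rejection_count_def by measurable
qed

text \<open>As \<open>E\<close> belongs to \<open>F\<close>, the indicator of \<open>A\<close> and
  its conditional probability have the same integral over \<open>E\<close>.\<close>

lemma (in prob_space) measure_inter_le_of_prob_given:
  assumes sub: "subalgebra M F" and E: "E \<in> sets F" and A: "A \<in> sets M"
    and le: "AE x in M. prob_given M F A x \<le> u"
  shows "prob (E \<inter> A) \<le> u * prob E"
proof -
  interpret finite_measure_subalgebra M F by unfold_locales (rule sub)
  have EM: "E \<in> sets M" using sub E by (auto simp: subalgebra_def)
  have int: "integrable M (indicator A :: _ \<Rightarrow> real)"
    using A by (intro integrable_real_indicator) (simp_all add: less_top[symmetric])
  have "prob (E \<inter> A) = (\<integral>x\<in>E. indicator A x \<partial>M)"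
    using A EM by (simp add: set_lebesgue_integral_def indicator_inter_arith[symmetric])
  also have "\<dots> = (\<integral>x\<in>E. prob_given M F A x \<partial>M)"
    unfolding prob_given_def using int E by (rule real_cond_exp_intA)
  also have "\<dots> \<le> (\<integral>x\<in>E. u \<partial>M)"
    unfolding set_lebesgue_integral_def
  proof (rule integral_mono_AE)
    show "integrable M (\<lambda>x. indicator E x *\<^sub>R prob_given M F A x)"
      unfolding prob_given_def by (intro integrable_mult_indicator EM real_cond_exp_int int)
    show "integrable M (\<lambda>x. indicator E x *\<^sub>R u)"
      by (intro integrable_mult_indicator EM) simp
    show "AE x in M. indicator E x *\<^sub>R prob_given M F A x \<le> indicator E x *\<^sub>R u"
      using le by eventually_elim (simp add: indicator_def)
  qed
  also have "\<dots> = u * prob E"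
    using EM by (simp add: set_lebesgue_integral_def)
  finally show ?thesis .
qed

section \<open>Integration of the pointwise bound\<close>

theorem theorem4p1:
  fixes M :: "'x measure" and \<Omega> :: "'x measure set" and \<omega> :: "nat \<Rightarrow> 'x measure set"
    and s :: nat and \<alpha> :: real and p :: "nat \<Rightarrow> 'x \<Rightarrow> real"
    and P :: "'x measure" and \<sigma> :: "'x \<Rightarrow> nat \<Rightarrow> nat"
  assumes "1 \<le> s" and "0 < \<alpha>" and "\<alpha> < 1"
    and "model_on M \<Omega>"
    and "\<And>i. i \<in> {1..s} \<Longrightarrow> \<omega> i \<subseteq> \<Omega>"
    and "\<And>i. i \<in> {1..s} \<Longrightarrow> p i \<in> borel_measurable M"
    and "\<And>i x. i \<in> {1..s} \<Longrightarrow> x \<in> space M \<Longrightarrow> p i x \<in> {0..1}"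
    and "\<And>i Q u. i \<in> {1..s} \<Longrightarrow> Q \<in> \<omega> i \<Longrightarrow> 0 < u \<Longrightarrow> u < 1 \<Longrightarrow>
           measure Q {x \<in> space Q. p i x \<le> u} \<le> u"
    and "P \<in> \<Omega>"
    and "\<And>i u. i \<in> true_nulls s \<omega> P \<Longrightarrow> 0 < u \<Longrightarrow> u < 1 \<Longrightarrow>
           (AE x in P. prob_given P (generated_by P ({1..s} - true_nulls s \<omega> P) p)
                         {y \<in> space P. p i y \<le> u} x \<le> u)"
    and "\<And>x. x \<in> space M \<Longrightarrow> orders_pvalues s (\<lambda>i. p i x) (\<sigma> x)"
  shows "FDR P (true_nulls s \<omega> P)
           (\<lambda>x. stepdown_rejected s (alpha_star s \<alpha>) (\<lambda>i. p i x) (\<sigma> x)) \<le> \<alpha>"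
proof -
  define T where "T = true_nulls s \<omega> P"
  define J where "J = {1..s} - T"
  define m where "m = card T"
  define c where "c = alpha_star s \<alpha>"
  define F where "F = generated_by P J p"
  have P: "prob_space P" "sets P = sets M" using assms(4,9) by (auto simp: model_on_def)
  interpret prob_space P by fact
  have sp: "space P = space M" using P(2) by (rule sets_eq_imp_space_eq)
  have pm: "p i \<in> borel_measurable P" if "i \<in> {1..s}" for i
    using assms(6)[OF that] P(2) by (simp cong: measurable_cong_sets)
  have T: "T \<subseteq> {1..s}" by (auto simp: T_def true_nulls_def)
  then have finT: "finite T" by (rule finite_subset) simp
  have cardJ: "m + card J = s"
    using T finT card_mono[OF _ T] by (simp add: J_def m_def card_Diff_subset)
  have sub: "subalgebra P F"
    unfolding F_def J_def by (intro subalgebra_generated_by pm) auto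
  have c: "mono_on {1..s} c" unfolding c_def using assms(2) by (intro mono_on_alpha_star) simp
  have ord: "orders_pvalues s (\<lambda>i. p i x) (\<sigma> x)" if "x \<in> space P" for x
    using assms(11) that sp by simp
  \<comment> \<open>\<open>k\<close> uses false p-values only, so the events \<open>E j\<close>
    split the sample space according to the data conditioned on.\<close>
  define k where "k x = rejection_count J c (\<lambda>i. p i x)" for x
  define E where "E j = {x \<in> space P. k x = j}" for j
  define A where "A i u = {x \<in> space P. p i x \<le> u}" for i u
  define w where "w j = real m / (real m + real j)" for j
  have EF: "E j \<in> sets F" for j
  proof -
    have [measurable]: "p i \<in> borel_measurable F" if "i \<in> J" for i
      unfolding F_def using that by (rule measurable_generated_by)
    have "{x \<in> space F. rejection_count J c (\<lambda>i. p i x) = j} \<in> sets F" by measurable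
    moreover have "space F = space P" using sub by (simp add: subalgebra_def)
    ultimately show ?thesis by (simp only: E_def k_def)
  qed
  then have EP: "E j \<in> sets P" for j using sub by (auto simp: subalgebra_def)
  have AP: "A i u \<in> sets P" if "i \<in> T" for i u
  proof -
    have [measurable]: "p i \<in> borel_measurable P" using that T by (intro pm) auto
    show ?thesis unfolding A_def by measurable
  qed
  have kle: "k x \<le> card J" for x unfolding k_def by (rule rejection_count_le_card)
  have bound: "FDP T (stepdown_rejected s c (\<lambda>i. p i x) (\<sigma> x))
      \<le> (\<Sum>j\<le>card J. \<Sum>i\<in>T. w j * indicator (E j \<inter> A i (c (Suc j))) x)"
    if x: "x \<in> space P" for x
  proof -
    have "FDP T (stepdown_rejected s c (\<lambda>i. p i x) (\<sigma> x))
        \<le> (\<Sum>i\<in>T. w (k x) * of_bool (p i x \<le> c (Suc (k x))))"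
      using FDP_stepdown_le[OF T c ord[OF x]] by (simp add: k_def w_def m_def J_def)
    also have "\<dots> = (\<Sum>i\<in>T. w (k x) * indicator (E (k x) \<inter> A i (c (Suc (k x)))) x)"
      using x by (intro sum.cong) (auto simp: E_def A_def indicator_def)
    \<comment> \<open>Splitting by the value of \<open>k\<close> turns the random threshold
      \<open>c (Suc (k x))\<close> into constants; the added terms are nonnegative.\<close>
    also have "\<dots> \<le> (\<Sum>j\<le>card J. \<Sum>i\<in>T. w j * indicator (E j \<inter> A i (c (Suc j))) x)"
      using kle by (intro member_le_sum[of "k x" _ "\<lambda>j. \<Sum>i\<in>T. w j * indicator (E j \<inter> A i (c (Suc j))) x"])
        (auto simp: w_def intro!: sum_nonneg)
    finally show ?thesis .
  qed
  have EA: "prob (E j \<inter> A i (c (Suc j))) \<le> c (Suc j) * prob (E j)"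
    if i: "i \<in> T" and j: "j \<le> card J" for i j
  \<comment> \<open>The conditional bound is assumed only for levels strictly between 0 and 1. A
    constant capped at 1 needs just monotonicity of the measure.\<close>
  proof (cases "c (Suc j) < 1")
    case True
    have "0 < m" using i finT by (auto simp: m_def card_gt_0_iff)
    then have "j < s" using j cardJ by simp
    then have "0 < c (Suc j)" using assms(1,2) by (simp add: c_def alpha_star_def)
    then have "AE x in P. prob_given P F (A i (c (Suc j))) x \<le> c (Suc j)"
      using assms(10)[of i "c (Suc j)"] i True unfolding A_def F_def J_def T_def by simp
    then show ?thesis by (rule measure_inter_le_of_prob_given[OF sub EF AP[OF i]])
  next
    case False
    then have "c (Suc j) = 1" by (simp add: c_def alpha_star_def)
    then show ?thesis using EP by (simp add: finite_measure_mono)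
  qed
  have int: "integrable P (\<lambda>x. w j * indicator (E j \<inter> A i (c (Suc j))) x)" if "i \<in> T" for i j
    using EP AP[OF that]
    by (intro integrable_mult_right integrable_real_indicator) (simp_all add: less_top[symmetric])
  have "FDR P T (\<lambda>x. stepdown_rejected s c (\<lambda>i. p i x) (\<sigma> x))
      \<le> (\<integral>x. (\<Sum>j\<le>card J. \<Sum>i\<in>T. w j * indicator (E j \<inter> A i (c (Suc j))) x) \<partial>P)"
    unfolding FDR_def
    by (intro integral_mono integrable_FDP_stepdown[OF P(1) pm ord c] bound
        Bochner_Integration.integrable_sum int)
  also have "\<dots> = (\<Sum>j\<le>card J. \<Sum>i\<in>T. w j * prob (E j \<inter> A i (c (Suc j))))"
  proof -
    have "(\<integral>x. w j * indicator (E j \<inter> A i (c (Suc j))) x \<partial>P) = w j * prob (E j \<inter> A i (c (Suc j)))"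
      if "i \<in> T" for i j
      using EP AP[OF that] by simp
    then show ?thesis
      by (simp only: Bochner_Integration.integral_sum Bochner_Integration.integrable_sum int
          cong: sum.cong)
  qed
  also have "\<dots> \<le> (\<Sum>j\<le>card J. \<Sum>i\<in>T. w j * (c (Suc j) * prob (E j)))"
    using EA by (intro sum_mono mult_left_mono) (auto simp: w_def)
  \<comment> \<open>The summand is constant in \<open>i\<close>, so the sum over \<open>T\<close>
    becomes the factor \<open>m\<close>.\<close>
  also have "\<dots> = (\<Sum>j\<le>card J. real m * (w j * c (Suc j)) * prob (E j))"
    by (simp add: m_def mult_ac)
  also have "\<dots> \<le> (\<Sum>j\<le>card J. \<alpha> * prob (E j))"
  proof (intro sum_mono mult_right_mono)
    fix j assume "j \<in> {..card J}"
    \<comment> \<open>For \<open>m = 0\<close> the index \<open>j\<close> can reach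
      \<open>s\<close>, where the denominator in \<open>c (Suc j)\<close> is 0; the factor
      \<open>m\<close> makes the term vanish.\<close>
    then show "real m * (w j * c (Suc j)) \<le> \<alpha>"
      using alpha_star_weight_le[of \<alpha> m j s] assms(2) cardJ
      by (cases "m = 0") (auto simp: w_def c_def)
  qed simp
  also have "\<dots> = \<alpha> * (\<Sum>j\<le>card J. prob (E j))" by (simp add: sum_distrib_left)
  also have "(\<Sum>j\<le>card J. prob (E j)) = prob (\<Union>j\<le>card J. E j)"
    using EP by (intro finite_measure_finite_Union[symmetric])
      (auto simp: disjoint_family_on_def E_def)
  also have "\<alpha> * \<dots> \<le> \<alpha> * 1" using assms(2) by (intro mult_left_mono) auto
  finally show ?thesis by (simp add: T_def c_def)
qed

end
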